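(* (i) Let $I$ be the radical ideal of a finite set $Z$ of points in $\mathbb{P}^2$ with $\widehat{\alpha}(I)=1$. Then $\alpha(I)=1$, i.e. $Z$ is contained in a line. (ii) For every integer $d\geq 2$ there exists a finite set $Z$ of points in $\mathbb{P}^2$ whose radical ideal $I$ satisfies $\widehat{\alpha}(I)=d$ and $\alpha(I)\geq d+1$.
   Context: The ground field is algebraically closed of characteristic $0$. For a finite set $Z=\{P_1,\dots,P_s\}\subset\mathbb{P}^2$, $I(P_i)$ is the homogeneous ideal of all forms vanishing at $P_i$, $I=I(Z)=\bigcap_i I(P_i)$, and for $m\geq 1$ the symbolic power is $I^{(m)}=\bigcap_i I(P_i)^m$. For a nonzero homogeneous ideal $J=\bigoplus_{d\geq 0}J_d$, the initial degree is $\alpha(J)=\min\{d: J_d\neq 0\}$. The Waldschmidt constant is $\widehat{\alpha}(I)=\lim_{m\to\infty}\alpha(I^{(m)})/m=\inf_{m\geq 1}\alpha(I^{(m)})/m$. *)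

theory Defs
  imports
    "HOL-Analysis.Analysis"
    "HOL-Library.Poly_Mapping"
    "HOL-Computational_Algebra.Polynomial"
begin

text \<open>
  Ternary polynomials are finitely supported maps from exponent vectors to coefficients. The
  variables are indexed by the three-element type \<^typ>\<open>3\<close>, as are the coordinates of the
  vectors in \<open>'k ^ 3\<close>.
\<close>

type_synonym 'k poly3 = "(3 \<Rightarrow>\<^sub>0 nat) \<Rightarrow>\<^sub>0 'k"

definition eval3 :: "'k::comm_ring_1 poly3 \<Rightarrow> 'k ^ 3 \<Rightarrow> 'k" where
  "eval3 f v = (\<Sum>e\<in>Poly_Mapping.keys f.
     Poly_Mapping.lookup f e * (\<Prod>i\<in>UNIV. (v $ i) ^ Poly_Mapping.lookup e i))"

text \<open>The zero polynomial is a form of every degree.\<close>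

definition form_of_degree :: "nat \<Rightarrow> 'k::zero poly3 \<Rightarrow> bool" where
  "form_of_degree d f \<longleftrightarrow>
     (\<forall>e\<in>Poly_Mapping.keys f. (\<Sum>i\<in>UNIV. Poly_Mapping.lookup e i) = d)"


text \<open>A point of the projective plane is a one-dimensional subspace of \<open>'k ^ 3\<close>.\<close>

definition proj_plane :: "('k::field ^ 3) set set" where
  "proj_plane = {vec.span {v} | v. v \<noteq> 0}"

definition proj_line :: "('k::field ^ 3) set set \<Rightarrow> bool" where
  "proj_line L \<longleftrightarrow>
     (\<exists>a. a \<noteq> 0 \<and> L = {P \<in> proj_plane. \<forall>v\<in>P. (\<Sum>i\<in>UNIV. a $ i * v $ i) = 0})"


text \<open>An ideal of a commutative ring is a submodule of the ring over itself.\<close>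

lemma module_times: "module ((*) :: 'a::comm_ring_1 \<Rightarrow> 'a \<Rightarrow> 'a)"
  by unfold_locales (simp_all add: algebra_simps)

definition ideal_gen :: "'a::comm_ring_1 set \<Rightarrow> 'a set" where
  "ideal_gen = module.span (*)"

fun ideal_power :: "'a::comm_ring_1 set \<Rightarrow> nat \<Rightarrow> 'a set" where
  "ideal_power J 0 = UNIV"
| "ideal_power J (Suc m) = ideal_gen {f * g | f g. f \<in> J \<and> g \<in> ideal_power J m}"

definition point_ideal :: "('k::field ^ 3) set \<Rightarrow> 'k poly3 set" where
  "point_ideal P = ideal_gen {f. (\<exists>d. form_of_degree d f) \<and> (\<forall>v\<in>P. eval3 f v = 0)}"

definition points_ideal :: "('k::field ^ 3) set set \<Rightarrow> 'k poly3 set" where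
  "points_ideal Z = (\<Inter>P\<in>Z. point_ideal P)"

definition symbolic_power :: "('k::field ^ 3) set set \<Rightarrow> nat \<Rightarrow> 'k poly3 set" where
  "symbolic_power Z m = (\<Inter>P\<in>Z. ideal_power (point_ideal P) m)"


definition initial_degree :: "'k::zero poly3 set \<Rightarrow> nat" where
  "initial_degree J = (LEAST d. \<exists>f\<in>J. f \<noteq> 0 \<and> form_of_degree d f)"

definition waldschmidt_constant :: "('k::field ^ 3) set set \<Rightarrow> real" where
  "waldschmidt_constant Z = lim (\<lambda>m. real (initial_degree (symbolic_power Z m)) / real m)"

end

theory Submission
  imports Defs
begin

text \<open>
  Let \<open>s\<close> lines be given, no three of them concurrent, and let \<open>f\<close> be a nonzero form of degree \<open>d\<close>
  that has multiplicity at least \<open>m\<close> at each of their intersection points. Write \<open>f\<close> as the product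
  of the powers \<open>L\<^sub>i ^ k\<^sub>i\<close> of the linear forms and of a form \<open>g\<close> that no \<open>L\<^sub>i\<close> divides. Bezout's
  theorem for \<open>g\<close> and \<open>L\<^sub>i\<close> gives \<open>(s - 1) m \<le> d + (s - 2) k\<^sub>i\<close>; summing over \<open>i\<close> and using that the
  \<open>k\<^sub>i\<close> add up to at most \<open>d\<close> gives \<open>s m \<le> 2 d\<close>. The product of all \<open>s\<close> lines attains this bound for
  \<open>m = 2\<close>, so the Waldschmidt constant of the intersection points is \<open>s / 2\<close>, and for \<open>m = 1\<close> the
  same inequalities give initial degree at least \<open>s - 1\<close>. Three noncollinear points are the case
  \<open>s = 3\<close>, which forces the constant up to \<open>3 / 2\<close>; part (ii) is the case \<open>s = 2 d\<close>.
\<close>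

subsection \<open>Ring homomorphisms and evaluation of ternary polynomials\<close>

text \<open>A predicate rather than a class or locale, so that evaluations, substitutions and
  constant embeddings between varying rings compose freely by rewriting.\<close>

definition ring_map :: "('a::comm_ring_1 \<Rightarrow> 'b::comm_ring_1) \<Rightarrow> bool" where
  "ring_map h \<longleftrightarrow> h 1 = 1 \<and> (\<forall>x y. h (x + y) = h x + h y) \<and> (\<forall>x y. h (x * y) = h x * h y)"

lemma ring_mapI:
  assumes "h 1 = 1" "\<And>x y. h (x + y) = h x + h y" "\<And>x y. h (x * y) = h x * h y"
  shows "ring_map h"
  using assms by (simp add: ring_map_def)

lemma ring_map_one: "ring_map h \<Longrightarrow> h 1 = 1"
  and ring_map_add: "ring_map h \<Longrightarrow> h (x + y) = h x + h y"
  and ring_map_mult: "ring_map h \<Longrightarrow> h (x * y) = h x * h y"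
  by (simp_all add: ring_map_def)

lemma ring_map_zero: "ring_map h \<Longrightarrow> h 0 = 0"
  by (metis ring_map_add add_cancel_right_right)

lemma ring_map_sum: "ring_map h \<Longrightarrow> h (sum f A) = (\<Sum>x\<in>A. h (f x))"
  by (induction A rule: infinite_finite_induct) (simp_all add: ring_map_zero ring_map_add)

lemma ring_map_power: "ring_map h \<Longrightarrow> h (x ^ n) = h x ^ n"
  by (induction n) (simp_all add: ring_map_one ring_map_mult)

lemma ring_map_prod: "ring_map h \<Longrightarrow> h (prod f A) = (\<Prod>x\<in>A. h (f x))"
  by (induction A rule: infinite_finite_induct) (simp_all add: ring_map_one ring_map_mult)

lemma ring_map_dvd: "ring_map h \<Longrightarrow> x dvd y \<Longrightarrow> h x dvd h y"
  by (auto simp: dvd_def ring_map_mult)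

lemma ring_map_id: "ring_map (\<lambda>x. x)"
  by (simp add: ring_map_def)

lemma ring_map_single: "ring_map (Poly_Mapping.single (0 :: 'e::comm_monoid_add))"
  by (simp add: ring_map_def single_add mult_single)

lemma ring_map_const_poly:
  assumes "ring_map h" shows "ring_map (\<lambda>a. [:h a:])"
  using assms by (simp add: ring_map_def)

lemma ring_map_poly: "ring_map (\<lambda>p. poly p x)"
  by (simp add: ring_map_def)

text \<open>Universal property of the univariate polynomial ring: the extension of a homomorphism
  \<open>h\<close> that sends the variable to \<open>y\<close>.\<close>

definition poly_lift :: "('a::comm_ring_1 \<Rightarrow> 'b::comm_ring_1) \<Rightarrow> 'b \<Rightarrow> 'a poly \<Rightarrow> 'b" where
  "poly_lift h y p = poly (map_poly h p) y"

lemma poly_lift_pCons: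
  assumes "ring_map h" shows "poly_lift h y (pCons a p) = h a + y * poly_lift h y p"
  using ring_map_zero[OF assms] by (simp add: poly_lift_def map_poly_pCons)

lemma poly_lift_0 [simp]: "poly_lift h y 0 = 0"
  by (simp add: poly_lift_def)

lemma poly_lift_add:
  assumes "ring_map h" shows "poly_lift h y (p + q) = poly_lift h y p + poly_lift h y q"
  by (induction p q rule: poly_induct2)
    (simp_all add: poly_lift_pCons[OF assms] ring_map_add[OF assms] algebra_simps)

lemma poly_lift_smult:
  assumes "ring_map h" shows "poly_lift h y (smult a p) = h a * poly_lift h y p"
  by (induction p)
    (simp_all add: poly_lift_pCons[OF assms] ring_map_mult[OF assms] algebra_simps)

lemma ring_map_poly_lift:
  assumes h: "ring_map h" shows "ring_map (poly_lift h y)"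
proof (rule ring_mapI)
  show "poly_lift h y 1 = 1"
    by (simp add: one_pCons poly_lift_pCons[OF h] ring_map_one[OF h])
  show "poly_lift h y (p + q) = poly_lift h y p + poly_lift h y q" for p q
    by (rule poly_lift_add[OF h])
  show "poly_lift h y (p * q) = poly_lift h y p * poly_lift h y q" for p q
    by (induction p) (simp_all add: poly_lift_pCons[OF h] poly_lift_add[OF h]
        poly_lift_smult[OF h] ring_map_zero[OF h] algebra_simps)
qed

text \<open>With values in an arbitrary ring, one substitution serves for values at points,
  restriction to lines, translation by a point and scaling of the variables.\<close>

definition peval :: "('k::comm_ring_1 \<Rightarrow> 'a::comm_ring_1) \<Rightarrow> (3 \<Rightarrow> 'a) \<Rightarrow> 'k poly3 \<Rightarrow> 'a" where
  "peval c x f = (\<Sum>e\<in>Poly_Mapping.keys f.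
     c (Poly_Mapping.lookup f e) * (\<Prod>i\<in>UNIV. x i ^ Poly_Mapping.lookup e i))"

abbreviation Const :: "'k::zero \<Rightarrow> 'k poly3" where
  "Const \<equiv> Poly_Mapping.single 0"

definition Var :: "3 \<Rightarrow> 'k::comm_ring_1 poly3" where
  "Var i = Poly_Mapping.single (Poly_Mapping.single i 1) 1"

lemma eval3_eq_peval: "eval3 f v = peval (\<lambda>a. a) (($) v) f"
  by (simp add: eval3_def peval_def)

lemma peval_single:
  assumes "ring_map c"
  shows "peval c x (Poly_Mapping.single e a) = c a * (\<Prod>i\<in>UNIV. x i ^ Poly_Mapping.lookup e i)"
  using ring_map_zero[OF assms] by (cases "a = 0") (simp_all add: peval_def)

lemma peval_add:
  assumes "ring_map c" shows "peval c x (f + g) = peval c x f + peval c x g"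
  unfolding peval_def
  by (rule setsum_keys_plus_distrib)
    (simp_all add: ring_map_zero[OF assms] ring_map_add[OF assms] algebra_simps)

lemma peval_zero [simp]: "peval c x 0 = 0"
  by (simp add: peval_def)

lemma poly_mapping_single_induct [case_names zero single_add]:
  fixes f :: "'a \<Rightarrow>\<^sub>0 'b::comm_monoid_add"
  assumes "P 0" and "\<And>e a f. P f \<Longrightarrow> P (Poly_Mapping.single e a + f)"
  shows "P f"
proof (induction f rule: update_induct)
  case const
  show ?case by (rule assms(1))
next
  case (update f a b)
  have "Poly_Mapping.update a b f = Poly_Mapping.single a b + f"
    using update.hyps
    by (intro poly_mapping_eqI)
      (auto simp: lookup_update lookup_add lookup_single in_keys_iff when_def)
  then show ?case using assms(2) update by simp
qed

lemma ring_map_peval: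
  assumes c: "ring_map c" shows "ring_map (peval c x)"
proof (rule ring_mapI)
  show "peval c x 1 = 1"
    using peval_single[OF c, of x 0 1] ring_map_one[OF c] by simp
  show "peval c x (f + g) = peval c x f + peval c x g" for f g
    by (rule peval_add[OF c])
  have single: "peval c x (Poly_Mapping.single e a * g)
      = peval c x (Poly_Mapping.single e a) * peval c x g" for e a g
    by (induction g rule: poly_mapping_single_induct)
      (simp_all add: peval_add[OF c] peval_single[OF c] mult_single distrib_left lookup_add
        power_add prod.distrib ring_map_mult[OF c] algebra_simps)
  show "peval c x (f * g) = peval c x f * peval c x g" for f g
    by (induction f rule: poly_mapping_single_induct)
      (simp_all add: peval_add[OF c] single distrib_right)
qed

lemma peval_Const:
  assumes "ring_map c" shows "peval c x (Const a) = c a"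
  by (simp add: peval_single[OF assms])

lemma peval_Var:
  assumes "ring_map c" shows "peval c x (Var i) = x i"
proof -
  have "(\<Prod>j\<in>UNIV. x j ^ Poly_Mapping.lookup (Poly_Mapping.single i 1) j)
      = (\<Prod>j\<in>UNIV. if j = i then x j else 1)"
    by (intro prod.cong) (auto simp: lookup_single when_def)
  then show ?thesis
    by (simp add: Var_def peval_single[OF assms] ring_map_one[OF assms])
qed

text \<open>Homomorphisms pass inside a substitution, so composites of substitutions can be compared
  on constants and variables alone.\<close>

lemma ring_map_comp_peval:
  assumes "ring_map h"
  shows "h (peval c x f) = peval (\<lambda>a. h (c a)) (\<lambda>i. h (x i)) f"
  by (simp add: peval_def ring_map_sum[OF assms] ring_map_mult[OF assms] ring_map_prod[OF assms]
      ring_map_power[OF assms])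

lemma prod_UNIV_3: "prod f (UNIV :: 3 set) = f 1 * f 2 * f 3"
  unfolding UNIV_3 by (simp add: ac_simps)

lemma Const_times_Vars:
  "Const a * (\<Prod>i\<in>UNIV. Var i ^ Poly_Mapping.lookup e i) = Poly_Mapping.single e a"
proof -
  have pow: "(Var i :: 'a poly3) ^ n = Poly_Mapping.single (Poly_Mapping.single i n) 1" for i n
    by (induction n) (simp_all add: Var_def mult_single single_add[symmetric])
  have "Poly_Mapping.single 1 (Poly_Mapping.lookup e 1) + (Poly_Mapping.single 2 (Poly_Mapping.lookup e 2)
      + Poly_Mapping.single 3 (Poly_Mapping.lookup e 3)) = e"
  proof (rule poly_mapping_eqI)
    fix k :: 3
    show "Poly_Mapping.lookup (Poly_Mapping.single 1 (Poly_Mapping.lookup e 1) + (Poly_Mapping.single 2 (Poly_Mapping.lookup e 2)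
      + Poly_Mapping.single 3 (Poly_Mapping.lookup e 3))) k = Poly_Mapping.lookup e k"
      using exhaust_3[of k] by (auto simp: lookup_add lookup_single)
  qed
  then show ?thesis
    by (simp add: prod_UNIV_3 pow mult_single add.assoc)
qed

lemma peval_Const_Var [simp]: "peval Const Var f = f"
proof -
  have "peval Const Var f = (\<Sum>e\<in>Poly_Mapping.keys f. Poly_Mapping.single e (Poly_Mapping.lookup f e))"
    by (simp add: peval_def Const_times_Vars)
  also have "\<dots> = f"
    by (intro poly_mapping_eqI)
      (auto simp: lookup_sum lookup_single when_def in_keys_iff)
  finally show ?thesis .
qed

lemma dvd_prod_diff:
  fixes l :: "'a::comm_ring_1"
  assumes "\<And>i. i \<in> A \<Longrightarrow> l dvd x i - y i"
  shows "l dvd prod x A - prod y A"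
  using assms
proof (induction A rule: infinite_finite_induct)
  case (insert i A)
  have "prod x (insert i A) - prod y (insert i A)
      = x i * (prod x A - prod y A) + (x i - y i) * prod y A"
    using insert.hyps by (simp add: algebra_simps)
  then show ?case using insert by (simp add: dvd_add dvd_mult dvd_mult2)
qed auto

lemma dvd_peval_diff:
  assumes "\<And>i. l dvd x i - y i"
  shows "l dvd peval c x f - peval c y f"
proof -
  have pow: "l dvd x i ^ n - y i ^ n" for i n
    using assms[of i] by (metis dvd_prod_diff prod_constant card_lessThan)
  have "peval c x f - peval c y f = (\<Sum>e\<in>Poly_Mapping.keys f. c (Poly_Mapping.lookup f e) *
      ((\<Prod>i\<in>UNIV. x i ^ Poly_Mapping.lookup e i) - (\<Prod>i\<in>UNIV. y i ^ Poly_Mapping.lookup e i)))"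
    by (simp add: peval_def sum_subtractf algebra_simps)
  also have "l dvd \<dots>"
    by (intro dvd_sum dvd_mult dvd_prod_diff pow)
  finally show ?thesis .
qed

lemma peval_homogeneous:
  assumes "form_of_degree d f"
  shows "peval c (\<lambda>i. s * x i) f = s ^ d * peval c x f"
proof -
  have "(\<Prod>i\<in>UNIV. (s * x i) ^ Poly_Mapping.lookup e i)
      = s ^ d * (\<Prod>i\<in>UNIV. x i ^ Poly_Mapping.lookup e i)" if "e \<in> Poly_Mapping.keys f" for e
  proof -
    have "d = (\<Sum>i\<in>UNIV. Poly_Mapping.lookup e i)"
      using assms that by (simp add: form_of_degree_def)
    then show ?thesis
      by (simp add: power_mult_distrib prod.distrib power_sum)
  qed
  then show ?thesis
    by (simp add: peval_def sum_distrib_left mult.left_commute)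
qed

section \<open>Homogeneity through scaling of the variables\<close>

definition graded :: "'k::comm_ring_1 poly3 \<Rightarrow> 'k poly3 poly" where
  "graded = peval (\<lambda>a. [:Const a:]) (\<lambda>i. [:0, Var i:])"

lemma ring_map_graded: "ring_map graded"
  unfolding graded_def by (intro ring_map_peval ring_map_const_poly ring_map_single)

lemma poly_graded_1: "poly (graded f) 1 = f"
  unfolding graded_def ring_map_comp_peval[OF ring_map_poly] by simp

lemma graded_eq_sum:
  "graded f = (\<Sum>e\<in>Poly_Mapping.keys f.
     monom (Poly_Mapping.single e (Poly_Mapping.lookup f e)) (\<Sum>i\<in>UNIV. Poly_Mapping.lookup e i))"
proof -
  have "[:Const a:] * (\<Prod>i\<in>UNIV. [:0, Var i:] ^ n i)
      = monom (Const a * (\<Prod>i\<in>UNIV. Var i ^ n i)) (\<Sum>i\<in>UNIV. n i)" for a :: 'a and n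
  proof -
    have v: "[:0, Var i:] = monom (Var i :: 'a poly3) 1" for i
      by (simp add: monom_Suc monom_0)
    have "[:Const a:] = monom (Const a) 0"
      by (simp add: monom_0)
    moreover have "(\<Prod>i\<in>UNIV. monom (Var i :: 'a poly3) 1 ^ n i)
        = monom (\<Prod>i\<in>UNIV. Var i ^ n i) (\<Sum>i\<in>UNIV. n i)"
      by (simp add: monom_power prod_UNIV_3 sum_3 mult_monom del: One_nat_def)
    ultimately show ?thesis
      by (simp add: v mult_monom del: One_nat_def)
  qed
  then show ?thesis
    by (simp add: graded_def peval_def Const_times_Vars)
qed

text \<open>\<open>graded f\<close> is f(tV), with V the vector of variables, and its coefficient at
  t^d is the degree \<open>d\<close> component of \<open>f\<close>. Homogeneity becomes an equation
  in a polynomial ring, where products are easy to handle.\<close>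

lemma form_of_degree_iff_graded: "form_of_degree d f \<longleftrightarrow> graded f = monom f d"
proof
  assume "form_of_degree d f"
  then have "graded f = (\<Sum>e\<in>Poly_Mapping.keys f.
     monom (Poly_Mapping.single e (Poly_Mapping.lookup f e)) d)"
    by (simp add: graded_eq_sum form_of_degree_def)
  also have "\<dots> = monom (\<Sum>e\<in>Poly_Mapping.keys f. Poly_Mapping.single e (Poly_Mapping.lookup f e)) d"
    by (rule poly_eqI) (simp add: coeff_sum)
  also have "(\<Sum>e\<in>Poly_Mapping.keys f. Poly_Mapping.single e (Poly_Mapping.lookup f e)) = f"
    by (intro poly_mapping_eqI) (auto simp: lookup_sum lookup_single when_def in_keys_iff)
  finally show "graded f = monom f d" .
next
  assume "graded f = monom f d"
  then have "f = coeff (graded f) d" by simp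
  also have "\<dots> = (\<Sum>e\<in>Poly_Mapping.keys f. if (\<Sum>i\<in>UNIV. Poly_Mapping.lookup e i) = d
      then Poly_Mapping.single e (Poly_Mapping.lookup f e) else 0)"
    by (simp add: graded_eq_sum coeff_sum)
  finally have f: "f = (\<Sum>e\<in>Poly_Mapping.keys f. if (\<Sum>i\<in>UNIV. Poly_Mapping.lookup e i) = d
      then Poly_Mapping.single e (Poly_Mapping.lookup f e) else 0)" .
  show "form_of_degree d f"
    unfolding form_of_degree_def
  proof
    fix e assume e: "e \<in> Poly_Mapping.keys f"
    show "(\<Sum>i\<in>UNIV. Poly_Mapping.lookup e i) = d"
    proof (rule ccontr)
      assume ne: "(\<Sum>i\<in>UNIV. Poly_Mapping.lookup e i) \<noteq> d"
      \<comment> \<open>At \<open>e\<close> every summand vanishes: the monomials other than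
        \<open>e\<close> contribute nothing there, and the one for \<open>e\<close> is removed by
        the degree test.\<close>
      have "Poly_Mapping.lookup f e = (\<Sum>e'\<in>Poly_Mapping.keys f.
         if e' = e then 0 else 0)"
        by (subst f, unfold lookup_sum, intro sum.cong) (use ne in \<open>auto simp: lookup_single when_def\<close>)
      then show False using e by (simp add: in_keys_iff)
    qed
  qed
qed

lemma form_of_degree_mult:
  fixes f g :: "'k::comm_ring_1 poly3"
  assumes "form_of_degree d f" "form_of_degree e g"
  shows "form_of_degree (d + e) (f * g)"
  using assms
  by (simp add: form_of_degree_iff_graded ring_map_mult[OF ring_map_graded] mult_monom)

lemma form_of_degree_1: "form_of_degree 0 1"
  by (simp add: form_of_degree_def)

lemma form_of_degree_prod:
  fixes f :: "'b \<Rightarrow> 'k::comm_ring_1 poly3"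
  assumes "\<And>x. x \<in> A \<Longrightarrow> form_of_degree (d x) (f x)"
  shows "form_of_degree (sum d A) (prod f A)"
  using assms
  by (induction A rule: infinite_finite_induct)
    (auto intro: form_of_degree_mult form_of_degree_1)

text \<open>Scaling the variables turns \<open>l * h\<close> into \<open>l\<close> times t times
  \<open>graded h\<close>. Since \<open>l\<close> is nonzero in a domain, comparing coefficients of
  t leaves \<open>graded h\<close> only its term of degree \<open>d - 1\<close>.\<close>

lemma form_of_degree_linear_quotient:
  fixes l h :: "'k::idom poly3"
  assumes l: "form_of_degree 1 l" and f: "form_of_degree d (l * h)" and nz: "l * h \<noteq> 0"
  shows "d > 0 \<and> form_of_degree (d - 1) h"
proof -
  have "monom (l * h) d = monom l 1 * graded h"
    using l f by (simp add: form_of_degree_iff_graded ring_map_mult[OF ring_map_graded])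
  also have "\<dots> = smult l (pCons 0 (graded h))"
    by (simp add: monom_Suc monom_0)
  finally have eq: "monom (l * h) d = smult l (pCons 0 (graded h))" .
  have coeff: "coeff (graded h) n = 0" if "Suc n \<noteq> d" for n
    using arg_cong[OF eq, of "\<lambda>p. coeff p (Suc n)"] that nz by auto
  have "d > 0"
  proof (rule ccontr)
    assume "\<not> d > 0"
    then have "graded h = 0" using coeff by (intro poly_eqI) auto
    then show False using poly_graded_1[of h] nz by simp
  qed
  have "graded h = monom (coeff (graded h) (d - 1)) (d - 1)"
    using coeff \<open>d > 0\<close> by (intro poly_eqI) auto
  then have "graded h = monom h (d - 1)"
    using poly_graded_1[of h] by (metis poly_monom power_one mult.right_neutral)
  then show ?thesis using \<open>d > 0\<close> by (simp add: form_of_degree_iff_graded)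
qed

subsection \<open>Multiplicities and divisibility by linear forms\<close>

definition dot :: "'a::comm_ring_1 ^ 3 \<Rightarrow> 'a ^ 3 \<Rightarrow> 'a" where
  "dot a v = (\<Sum>i\<in>UNIV. a $ i * v $ i)"

definition linear_form :: "'k::comm_ring_1 ^ 3 \<Rightarrow> 'k poly3" where
  "linear_form a = (\<Sum>i\<in>UNIV. Const (a $ i) * Var i)"

definition cross :: "'a::comm_ring_1 ^ 3 \<Rightarrow> 'a ^ 3 \<Rightarrow> 'a ^ 3" where
  "cross a b = vector [a $ 2 * b $ 3 - a $ 3 * b $ 2, a $ 3 * b $ 1 - a $ 1 * b $ 3,
     a $ 1 * b $ 2 - a $ 2 * b $ 1]"

lemma cross_nth [simp]:
  "cross a b $ 1 = a $ 2 * b $ 3 - a $ 3 * b $ 2"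
  "cross a b $ 2 = a $ 3 * b $ 1 - a $ 1 * b $ 3"
  "cross a b $ 3 = a $ 1 * b $ 2 - a $ 2 * b $ 1"
  by (simp_all add: cross_def vector_3)

lemma cross_eq_0D:
  assumes "cross a b = 0" shows "a $ i * b $ j = b $ i * a $ j"
proof -
  have "cross a b $ 1 = 0" "cross a b $ 2 = 0" "cross a b $ 3 = 0"
    using assms by (simp_all del: cross_nth)
  then show ?thesis
    using exhaust_3[of i] exhaust_3[of j] by (auto simp: mult.commute)
qed

lemma dot_eq: "dot a v = a $ 1 * v $ 1 + a $ 2 * v $ 2 + a $ 3 * v $ 3"
  by (simp add: dot_def sum_3)

lemma dot_cross_self [simp]: "dot (cross a b) a = 0" "dot (cross a b) b = 0"
  by (simp_all add: dot_eq algebra_simps)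

lemma dot_cross_rotate: "dot (cross a b) c = dot (cross b c) a"
  by (simp add: dot_eq algebra_simps)

lemma dot_diff: "dot a (x - y) = dot a x - dot a y"
  by (simp add: dot_def sum_subtractf algebra_simps)

lemma peval_linear_form:
  assumes "ring_map c" shows "peval c x (linear_form a) = (\<Sum>i\<in>UNIV. c (a $ i) * x i)"
  using ring_map_peval[OF assms]
  by (simp add: linear_form_def ring_map_sum ring_map_mult peval_Const[OF assms] peval_Var[OF assms])

lemma form_of_degree_linear_form: "form_of_degree 1 (linear_form a)"
proof -
  have "monom (linear_form a) (Suc 0) = (\<Sum>i\<in>UNIV. monom (Const (a $ i) * Var i) (Suc 0))"
    by (simp add: linear_form_def sum_3 add_monom)
  then show ?thesis
    by (simp add: form_of_degree_iff_graded graded_def monom_Suc monom_0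
        peval_linear_form[OF ring_map_const_poly[OF ring_map_single]] mult.commute)
qed

lemma linear_form_eq_0_iff [simp]: "linear_form a = 0 \<longleftrightarrow> a = 0"
proof
  assume z: "linear_form a = 0"
  show "a = 0"
  proof (rule vec_eq_iff[THEN iffD2], rule allI)
    fix j
    have "0 = peval (\<lambda>x. x) (\<lambda>i. if i = j then 1 else 0) (linear_form a)"
      using z by simp
    also have "\<dots> = (\<Sum>i\<in>UNIV. if i = j then a $ i else 0)"
      unfolding peval_linear_form[OF ring_map_id] by (intro sum.cong) auto
    also have "\<dots> = a $ j" by simp
    finally show "a $ j = 0 $ j" by simp
  qed
qed (simp add: linear_form_def)

text \<open>The generic translate \<open>f (p + t V)\<close> of a polynomial, where \<open>V\<close> is the vector of variables:
  its order at \<open>t = 0\<close> is the multiplicity of \<open>f\<close> at \<open>p\<close>.\<close>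

definition shift :: "'k::comm_ring_1 ^ 3 \<Rightarrow> 'k poly3 \<Rightarrow> 'k poly3 poly" where
  "shift p = peval (\<lambda>a. [:Const a:]) (\<lambda>i. [:Const (p $ i), Var i:])"

lemma ring_map_shift: "ring_map (shift p)"
  unfolding shift_def by (intro ring_map_peval ring_map_const_poly ring_map_single)

lemma shift_eq_0_iff [simp]: "shift p f = 0 \<longleftrightarrow> f = 0"
proof
  assume z: "shift p f = 0"
  let ?h = "peval Const (\<lambda>i. Var i - Const (p $ i)) :: 'a poly3 \<Rightarrow> 'a poly3"
  have h: "ring_map ?h"
    by (intro ring_map_peval ring_map_single)
  \<comment> \<open>Setting t = 1 gives f(p + V), and \<open>?h\<close> translates back by
    subtracting \<open>p\<close> from the variables.\<close>
  have "f = ?h (poly (shift p f) 1)"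
    by (simp add: shift_def ring_map_comp_peval[OF ring_map_poly] ring_map_comp_peval[OF h]
        ring_map_add[OF h] peval_Const[OF ring_map_single] peval_Var[OF ring_map_single])
  then show "f = 0" using z by simp
qed (simp add: ring_map_zero[OF ring_map_shift])

lemma shift_linear_form: "shift p (linear_form a) = [:Const (dot a p), linear_form a:]"
proof -
  have "shift p (linear_form a)
      = (\<Sum>i\<in>UNIV. [:Const (a $ i) * Const (p $ i), Const (a $ i) * Var i:])"
    by (simp add: shift_def peval_linear_form[OF ring_map_const_poly[OF ring_map_single]] mult.commute)
  then show ?thesis
    by (simp add: sum_3 dot_eq linear_form_def single_add mult_single)
qed

definition mult_at :: "'k::idom ^ 3 \<Rightarrow> 'k poly3 \<Rightarrow> nat" where
  "mult_at p f = order 0 (shift p f)"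

lemma mult_at_mult: "f * g \<noteq> 0 \<Longrightarrow> mult_at p (f * g) = mult_at p f + mult_at p g"
  unfolding mult_at_def ring_map_mult[OF ring_map_shift]
  by (rule order_mult) simp

lemma mult_at_one: "mult_at p 1 = 0"
  by (simp add: mult_at_def ring_map_one[OF ring_map_shift])

lemma mult_at_power: "f \<noteq> 0 \<Longrightarrow> mult_at p (f ^ n) = n * mult_at p f"
  by (induction n) (simp_all add: mult_at_one mult_at_mult)

lemma mult_at_prod:
  assumes "finite A" "\<And>x. x \<in> A \<Longrightarrow> f x \<noteq> 0"
  shows "mult_at p (prod f A) = (\<Sum>x\<in>A. mult_at p (f x))"
  using assms by (induction A rule: finite_induct) (simp_all add: mult_at_one mult_at_mult)

lemma mult_at_linear_form:
  assumes "a \<noteq> 0" shows "mult_at p (linear_form a) = (if dot a p = 0 then 1 else 0)"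
proof (cases "dot a p = 0")
  case True
  have "shift p (linear_form a) = smult (linear_form a) ([:- 0, 1:] ^ 1)"
    by (simp add: shift_linear_form True)
  then show ?thesis
    using assms True order_power_n_n[of "0 :: 'a poly3" 1]
    by (simp only: mult_at_def order_smult linear_form_eq_0_iff if_True refl not_False_eq_True simp_thms)
next
  case False
  have "Const (dot a p) \<noteq> 0"
    using False by (metis lookup_single_eq lookup_zero)
  then have "order 0 (shift p (linear_form a)) = 0"
    by (intro order_0I) (simp add: shift_linear_form)
  then show ?thesis using False by (simp add: mult_at_def)
qed

section \<open>Restriction to a line and divisibility by its equation\<close>

lemma degree_peval_pencil:
  fixes u w :: "3 \<Rightarrow> 'k::comm_ring_1"
  assumes "form_of_degree d f"
  shows "degree (peval (\<lambda>a. [:a:]) (\<lambda>i. [:u i, w i:]) f) \<le> d"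
  unfolding peval_def
proof (rule degree_sum_le)
  fix e assume e: "e \<in> Poly_Mapping.keys f"
  have "degree (\<Prod>i\<in>UNIV. [:u i, w i:] ^ Poly_Mapping.lookup e i)
      \<le> (\<Sum>i\<in>UNIV. degree ([:u i, w i:] ^ Poly_Mapping.lookup e i))"
    using degree_prod_sum_le[of UNIV "\<lambda>i. [:u i, w i:] ^ Poly_Mapping.lookup e i"] by (simp add: o_def)
  also have "\<dots> \<le> (\<Sum>i\<in>UNIV. Poly_Mapping.lookup e i)"
  proof (rule sum_mono)
    fix i
    have "degree ([:u i, w i:] ^ Poly_Mapping.lookup e i) \<le> degree [:u i, w i:] * Poly_Mapping.lookup e i"
      by (rule degree_power_le)
    also have "\<dots> \<le> 1 * Poly_Mapping.lookup e i"
      by (rule mult_right_mono) (simp_all add: degree_pCons_le)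
    finally show "degree ([:u i, w i:] ^ Poly_Mapping.lookup e i) \<le> Poly_Mapping.lookup e i" by simp
  qed
  also have "\<dots> = d"
    using assms e by (simp add: form_of_degree_def)
  finally have "degree (\<Prod>i\<in>UNIV. [:u i, w i:] ^ Poly_Mapping.lookup e i) \<le> d" .
  then show "degree ([:Poly_Mapping.lookup f e:] * (\<Prod>i\<in>UNIV. [:u i, w i:] ^ Poly_Mapping.lookup e i)) \<le> d"
    by (simp add: degree_smult_le[THEN order_trans])
qed simp

lemma sum_le_degree:
  fixes h :: "'k::idom poly"
  assumes "finite J" "inj_on \<tau> J" "h \<noteq> 0" "\<And>j. j \<in> J \<Longrightarrow> [:- \<tau> j, 1:] ^ \<mu> j dvd h"
  shows "(\<Sum>j\<in>J. \<mu> j) \<le> degree h"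
proof -
  let ?R = "{x. poly h x = 0}"
  have fin: "finite ?R" using assms(3) by (rule poly_roots_finite)
  have "(\<Sum>j\<in>J. \<mu> j) \<le> (\<Sum>j\<in>J. order (\<tau> j) h)"
    using assms(3,4) by (intro sum_mono) (auto simp: order_divides)
  also have "\<dots> = (\<Sum>x\<in>\<tau> ` J. order x h)"
    using assms(2) by (simp add: sum.reindex)
  also have "\<dots> = (\<Sum>x\<in>\<tau> ` J \<inter> ?R. order x h)"
    using assms(1) by (intro sum.mono_neutral_right) (auto simp: order_0I)
  also have "\<dots> \<le> (\<Sum>x\<in>?R. order x h)"
    using fin by (intro sum_mono2) auto
  also have "\<dots> \<le> degree h"
    by (rule sum_order_le_degree[OF assms(3)])
  finally show ?thesis .
qed

text \<open>From (\<alpha> x \<beta>) x e = \<beta> (\<alpha> . e) - \<alpha> (\<beta> . e): once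
  \<beta> . e = 0, the vectors \<alpha> x \<beta> and \<open>e\<close> are proportional modulo
  \<alpha> . e. Over the field this parametrises a line; over the polynomial ring it describes a
  generic point of it.\<close>

lemma dvd_cross_minor:
  fixes e :: "3 \<Rightarrow> 'a::comm_ring_1"
  assumes "(\<Sum>i\<in>UNIV. \<beta> $ i * e i) = 0"
  shows "(\<Sum>i\<in>UNIV. \<alpha> $ i * e i) dvd cross \<alpha> \<beta> $ k * e j - cross \<alpha> \<beta> $ j * e k"
proof -
  let ?A = "\<alpha> $ 1 * e 1 + \<alpha> $ 2 * e 2 + \<alpha> $ 3 * e 3" and ?w = "cross \<alpha> \<beta>"
  have B: "\<beta> $ 1 * e 1 + \<beta> $ 2 * e 2 + \<beta> $ 3 * e 3 = 0"
    using assms by (simp add: sum_3)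
  have *: "?w $ 2 * e 1 - ?w $ 1 * e 2 = \<beta> $ 3 * - ?A + \<alpha> $ 3 * (\<beta> $ 1 * e 1 + \<beta> $ 2 * e 2 + \<beta> $ 3 * e 3)"
    "?w $ 3 * e 2 - ?w $ 2 * e 3 = \<beta> $ 1 * - ?A + \<alpha> $ 1 * (\<beta> $ 1 * e 1 + \<beta> $ 2 * e 2 + \<beta> $ 3 * e 3)"
    "?w $ 1 * e 3 - ?w $ 3 * e 1 = \<beta> $ 2 * - ?A + \<alpha> $ 2 * (\<beta> $ 1 * e 1 + \<beta> $ 2 * e 2 + \<beta> $ 3 * e 3)"
    by (simp_all add: algebra_simps)
  have d: "?A dvd ?w $ 2 * e 1 - ?w $ 1 * e 2" "?A dvd ?w $ 3 * e 2 - ?w $ 2 * e 3"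
    "?A dvd ?w $ 1 * e 3 - ?w $ 3 * e 1"
    unfolding * B by (simp_all only: mult_zero_right add_0_right dvd_mult dvd_minus_iff dvd_refl)
  then have "?A dvd ?w $ 1 * e 2 - ?w $ 2 * e 1" "?A dvd ?w $ 2 * e 3 - ?w $ 3 * e 2"
    "?A dvd ?w $ 3 * e 1 - ?w $ 1 * e 3"
    by (metis dvd_minus_iff minus_diff_eq)+
  with d have "?A dvd ?w $ k * e j - ?w $ j * e k"
    using exhaust_3[of k] exhaust_3[of j] by (auto simp del: cross_nth)
  then show ?thesis by (simp add: sum_3)
qed

text \<open>Bezout for a line: a form with more zeros on the line than its degree, counted with
  multiplicity, vanishes on the line. The chart \<open>dot b = 1\<close> fixes the scaling of
  representatives, so distinct vectors \<open>q j\<close> are distinct points.\<close>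

lemma linear_form_dvd:
  fixes f :: "'k::field_char_0 poly3" and q :: "'j \<Rightarrow> 'k ^ 3"
  assumes f: "form_of_degree d f" "f \<noteq> 0" and a: "a \<noteq> 0" and J: "finite J" "inj_on q J"
    and q: "\<And>j. j \<in> J \<Longrightarrow> dot a (q j) = 0" "\<And>j. j \<in> J \<Longrightarrow> dot b (q j) = 1"
    and less: "d < (\<Sum>j\<in>J. mult_at (q j) f)"
  shows "linear_form a dvd f"
proof -
  obtain j0 where j0: "j0 \<in> J" using less by (cases "J = {}") auto
  define u where "u = q j0"
  define w where "w = cross a b"
  have minor: "w $ k * x $ j = w $ j * x $ k" if "dot a x = 0" "dot b x = 0" for x k j
    using dvd_cross_minor[of b "($) x" a k j] that by (simp add: dot_def w_def)
  \<comment> \<open>The line is parametrised by \<open>u + t w\<close>, and each \<open>q j\<close> is the point with parameter \<open>\<tau> j\<close>; the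
    restriction \<open>h\<close> of \<open>f\<close> to the line then has more roots than its degree allows.\<close>
  have "\<exists>k. w $ k \<noteq> 0"
  proof (rule ccontr)
    assume "\<not> (\<exists>k. w $ k \<noteq> 0)"
    then have "cross a b = 0" by (simp add: w_def vec_eq_iff)
    obtain i where i: "a $ i \<noteq> 0" using a by (metis vec_eq_iff zero_index)
    have "a $ i * b $ j = b $ i * a $ j" for j
      by (rule cross_eq_0D[OF \<open>cross a b = 0\<close>])
    \<comment> \<open>With \<open>a\<close> and \<open>b\<close> proportional, their values 0 and 1
      at \<open>u\<close> would force \<open>a $ i = 0\<close>.\<close>
    then have "a $ i * dot b u = b $ i * dot a u"
      by (simp add: dot_eq distrib_left mult.assoc[symmetric])
    then show False using q j0 i by (simp add: u_def)
  qed
  then obtain k where k: "w $ k \<noteq> 0" by blast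
  define \<tau> where "\<tau> j = (q j - u) $ k / w $ k" for j
  have q_eq: "q j $ i = u $ i + \<tau> j * w $ i" if "j \<in> J" for j i
  proof -
    have "w $ k * (q j - u) $ i = w $ i * (q j - u) $ k"
      by (rule minor) (use q that j0 in \<open>simp_all add: dot_diff u_def\<close>)
    then have "\<tau> j * w $ i = (q j - u) $ i"
      using k by (simp add: \<tau>_def field_simps)
    then show ?thesis by simp
  qed
  define h where "h = peval (\<lambda>a. [:a:]) (\<lambda>i. [:u $ i, w $ i:]) f"
  have "h = 0"
  proof (rule ccontr)
    assume h0: "h \<noteq> 0"
    have "(\<Sum>j\<in>J. mult_at (q j) f) \<le> degree h"
    proof (rule sum_le_degree[OF J(1) _ h0])
      show "inj_on \<tau> J"
        using J(2) q_eq by (auto simp: inj_on_def vec_eq_iff)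
      fix j assume j: "j \<in> J"
      \<comment> \<open>\<open>\<phi>\<close> sends the variables to \<open>w\<close> and t to t -
        \<open>\<tau> j\<close>. It carries \<open>q j\<close> + tV to u + t w, so a power of t
        dividing \<open>shift (q j) f\<close> becomes the same power of t - \<open>\<tau> j\<close>
        dividing \<open>h\<close>.\<close>
      define \<phi> where "\<phi> = poly_lift (\<lambda>g. [:peval (\<lambda>x. x) (($) w) g:]) [:- \<tau> j, 1:]"
      have \<psi>: "ring_map (\<lambda>g. [:peval (\<lambda>x. x) (($) w) g:])"
        by (intro ring_map_const_poly ring_map_peval ring_map_id)
      have \<phi>: "ring_map \<phi>"
        unfolding \<phi>_def by (rule ring_map_poly_lift[OF \<psi>])
      have "\<phi> (shift (q j) f) = h"
        unfolding shift_def h_def ring_map_comp_peval[OF \<phi>]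
        by (simp add: \<phi>_def poly_lift_pCons[OF \<psi>] peval_Const[OF ring_map_id] peval_Var[OF ring_map_id]
            q_eq[OF j])
      moreover have "[:0, 1:] ^ mult_at (q j) f dvd shift (q j) f"
        using order_1[of 0 "shift (q j) f"] by (simp add: mult_at_def)
      from ring_map_dvd[OF \<phi> this] have "\<phi> [:0, 1:] ^ mult_at (q j) f dvd \<phi> (shift (q j) f)"
        by (simp add: ring_map_power[OF \<phi>])
      moreover have "\<phi> [:0, 1:] = [:- \<tau> j, 1:]"
        using ring_map_one[OF ring_map_peval[OF ring_map_id, of "($) w"]]
        by (simp add: \<phi>_def poly_lift_pCons[OF \<psi>])
      ultimately show "[:- \<tau> j, 1:] ^ mult_at (q j) f dvd h" by simp
    qed
    also have "\<dots> \<le> d"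
      unfolding h_def by (rule degree_peval_pencil[OF f(1)])
    finally show False using less by simp
  qed
  \<comment> \<open>Modulo \<open>linear_form a\<close>, the vector of variables is \<open>A u + B w\<close>, a generic point of the line. That
    \<open>f\<close> vanishes there follows from \<open>h = 0\<close>: the polynomial \<open>f (T u + B w)\<close> has as roots all nonzero
    constants \<open>T\<close>.\<close>
  define A where "A = linear_form b"
  define e where "e i = Var i - A * Const (u $ i)" for i
  \<comment> \<open>\<open>B\<close> makes A u + B w agree with V exactly in coordinate
    \<open>k\<close>; the other coordinates will agree modulo \<open>linear_form a\<close>.\<close>
  define B where "B = Const (1 / w $ k) * e k"
  have C: "ring_map (Const :: 'k \<Rightarrow> _)" by (rule ring_map_single)
  define Q where "Q = peval (\<lambda>a. [:Const a:]) (\<lambda>i. [:B * Const (w $ i), Const (u $ i):]) f"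
  have Q: "poly Q y = peval Const (\<lambda>i. B * Const (w $ i) + y * Const (u $ i)) f" for y
    by (simp add: Q_def ring_map_comp_peval[OF ring_map_poly])
  have root: "poly Q (Const \<alpha>) = 0" if "\<alpha> \<noteq> 0" for \<alpha>
  proof -
    have one: "Const \<alpha> * Const (1 / \<alpha>) = 1"
      using that by (simp add: mult_single)
    \<comment> \<open>Homogeneity takes out the factor \<open>\<alpha> ^ d\<close> and leaves the
      restriction \<open>h\<close> at the parameter B / \<alpha>.\<close>
    have "B * Const (w $ i) + Const \<alpha> * Const (u $ i)
        = Const \<alpha> * (Const (u $ i) + (Const (1 / \<alpha>) * B) * Const (w $ i))" for i
      using one by (simp add: distrib_left mult.assoc[symmetric])
    then have "poly Q (Const \<alpha>) = Const \<alpha> ^ d *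
        peval Const (\<lambda>i. Const (u $ i) + (Const (1 / \<alpha>) * B) * Const (w $ i)) f"
      by (simp add: Q peval_homogeneous[OF f(1)])
    also have "peval Const (\<lambda>i. Const (u $ i) + (Const (1 / \<alpha>) * B) * Const (w $ i)) f
        = poly_lift Const (Const (1 / \<alpha>) * B) h"
      by (simp add: h_def ring_map_comp_peval[OF ring_map_poly_lift[OF C]] poly_lift_pCons[OF C])
    finally show ?thesis using \<open>h = 0\<close> by simp
  qed
  have "Q = 0"
  proof (rule ccontr)
    assume "Q \<noteq> 0"
    then have "finite {y. poly Q y = 0}" by (rule poly_roots_finite)
    then have "finite (Const ` (UNIV - {0 :: 'k}))"
      by (rule finite_subset[rotated]) (use root in auto)
    then have "finite (UNIV - {0 :: 'k})"
      by (rule finite_imageD) (rule inj_on_subset[OF inj_single subset_UNIV])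
    then show False by (simp add: infinite_UNIV_char_0)
  qed
  have "linear_form a dvd Var j - (B * Const (w $ j) + A * Const (u $ j))" for j
  proof -
    have v: "(\<Sum>i\<in>UNIV. Const (c $ i) * e i) = linear_form c - A * Const (dot c u)" for c
      by (simp add: e_def sum_3 linear_form_def dot_eq single_add ring_map_mult[OF C] algebra_simps)
    let ?V = "\<lambda>c. \<chi> i. Const (c $ i)"
    \<comment> \<open>The sum equals \<open>linear_form b - A * Const (dot b u)\<close>, and
      \<open>dot b u = 1\<close>.\<close>
    have "(\<Sum>i\<in>UNIV. ?V b $ i * e i) = 0"
      using q(2) j0 by (simp add: v A_def u_def)
    then have "(\<Sum>i\<in>UNIV. ?V a $ i * e i) dvd cross (?V a) (?V b) $ k * e j - cross (?V a) (?V b) $ j * e k"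
      by (rule dvd_cross_minor)
    moreover have "cross (?V a) (?V b) $ i = Const (w $ i)" for i
      using exhaust_3[of i] by (auto simp: w_def mult_single single_diff)
    ultimately have "linear_form a dvd Const (w $ k) * e j - Const (w $ j) * e k"
      using q(1) j0 by (simp add: v u_def)
    then have "linear_form a dvd Const (1 / w $ k) * (Const (w $ k) * e j - Const (w $ j) * e k)"
      by (rule dvd_mult)
    also have "\<dots> = (Const (1 / w $ k) * Const (w $ k)) * e j - B * Const (w $ j)"
      by (simp add: B_def algebra_simps)
    also have "Const (1 / w $ k) * Const (w $ k) = 1"
      using k by (simp add: mult_single)
    finally show ?thesis by (simp add: e_def algebra_simps)
  qed
  then have "linear_form a dvd peval Const Var f
      - peval Const (\<lambda>j. B * Const (w $ j) + A * Const (u $ j)) f"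
    by (rule dvd_peval_diff)
  then show ?thesis
    using Q[of A] \<open>Q = 0\<close> by simp
qed

subsection \<open>Star configurations\<close>

text \<open>Each division by a linear form lowers the degree by one, so induction on
  \<open>d\<close> ends the process. The equation for \<open>d\<close> both bounds the sum of the
  exponents and fixes the degree left for \<open>g\<close>.\<close>

lemma extract_linear_forms:
  fixes f :: "'k::idom poly3" and s :: nat
  assumes "form_of_degree d f" "f \<noteq> 0"
  shows "\<exists>k g e. f = (\<Prod>i<s. linear_form (a i) ^ k i) * g \<and> form_of_degree e g
      \<and> d = (\<Sum>i<s. k i) + e \<and> (\<forall>i<s. \<not> linear_form (a i) dvd g)"
  using assms
proof (induction d arbitrary: f rule: less_induct)
  case (less d)
  show ?case
  proof (cases "\<exists>i<s. linear_form (a i) dvd f")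
    case False
    then show ?thesis
      using less.prems by (intro exI[of _ "\<lambda>_. 0"] exI[of _ f] exI[of _ d]) simp
  next
    case True
    then obtain i h where i: "i < s" and f: "f = linear_form (a i) * h" by (auto simp: dvd_def)
    have dh: "d > 0" "form_of_degree (d - 1) h"
      using form_of_degree_linear_quotient[OF form_of_degree_linear_form] less.prems f by blast+
    have "h \<noteq> 0" using less.prems f by auto
    from less.IH[OF _ dh(2) this] dh(1) obtain k g e where
      kge: "h = (\<Prod>i<s. linear_form (a i) ^ k i) * g" "form_of_degree e g"
      "d - 1 = (\<Sum>i<s. k i) + e" "\<forall>i<s. \<not> linear_form (a i) dvd g"
      by auto
    define k' where "k' = k(i := Suc (k i))"
    have "(\<Prod>j<s. linear_form (a j) ^ k' j)
        = (\<Prod>j<s. linear_form (a j) ^ k j * (if j = i then linear_form (a i) else 1))"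
      by (intro prod.cong) (auto simp: k'_def)
    then have "f = (\<Prod>j<s. linear_form (a j) ^ k' j) * g"
      using i by (simp add: f kge(1) prod.distrib mult_ac)
    moreover have "(\<Sum>j<s. k' j) = (\<Sum>j<s. k j + (if j = i then 1 else 0))"
      by (intro sum.cong) (auto simp: k'_def)
    then have "d = (\<Sum>j<s. k' j) + e"
      using i kge(3) dh(1) by (simp add: sum.distrib)
    ultimately show ?thesis
      using kge(2,4) by blast
  qed
qed

text \<open>The points \<open>p i j\<close> are the pairwise intersections of the lines \<open>a i\<close>, no three of which are
  concurrent; the condition on \<open>b\<close> says that their representatives lie on an affine chart.\<close>

definition star_configuration ::
  "nat \<Rightarrow> (nat \<Rightarrow> 'k::field ^ 3) \<Rightarrow> 'k ^ 3 \<Rightarrow> (nat \<Rightarrow> nat \<Rightarrow> 'k ^ 3) \<Rightarrow> bool" where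
  "star_configuration s a b p \<longleftrightarrow> (\<forall>i<s. a i \<noteq> 0) \<and>
     (\<forall>i<s. \<forall>j<s. i \<noteq> j \<longrightarrow> dot b (p i j) = 1 \<and>
        (\<forall>l<s. dot (a l) (p i j) = 0 \<longleftrightarrow> l = i \<or> l = j))"

text \<open>On line \<open>i\<close> the cofactor \<open>g\<close> of degree \<open>e\<close> has
  multiplicity at least \<open>m - k i - k j\<close> at \<open>p i j\<close>. Summing over the other
  \<open>j\<close> counts \<open>k i\<close> in total \<open>s - 1\<close> times and every other
  exponent once; \<open>d\<close> absorbs one copy of each, leaving \<open>s - 2\<close> copies of
  \<open>k i\<close>.\<close>

lemma star_multiplicities:
  fixes f :: "'k::field_char_0 poly3"
  assumes star: "star_configuration s a b p" and s: "s \<ge> 2"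
    and f: "form_of_degree d f" "f \<noteq> 0"
    and m: "\<And>i j. i < s \<Longrightarrow> j < s \<Longrightarrow> i \<noteq> j \<Longrightarrow> m \<le> mult_at (p i j) f"
  obtains k :: "nat \<Rightarrow> nat" where "(\<Sum>i<s. k i) \<le> d"
    "\<And>i. i < s \<Longrightarrow> (s - 1) * m \<le> d + (s - 2) * k i"
proof -
  have a0: "a i \<noteq> 0" if "i < s" for i
    using star that by (simp add: star_configuration_def)
  have b: "dot b (p i j) = 1" if "i < s" "j < s" "i \<noteq> j" for i j
    using star that by (simp add: star_configuration_def)
  have a: "dot (a l) (p i j) = 0 \<longleftrightarrow> l = i \<or> l = j" if "i < s" "j < s" "i \<noteq> j" "l < s" for i j l
    using star that unfolding star_configuration_def by blast
  obtain k g e where fg: "f = (\<Prod>i<s. linear_form (a i) ^ k i) * g" and g: "form_of_degree e g"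
    and d: "d = (\<Sum>i<s. k i) + e" and ndvd: "\<And>i. i < s \<Longrightarrow> \<not> linear_form (a i) dvd g"
    using extract_linear_forms[OF f, of a s] by blast
  have "g \<noteq> 0" using f(2) fg by auto
  have bound: "m \<le> k i + k j + mult_at (p i j) g" if ij: "i < s" "j < s" "i \<noteq> j" for i j
  proof -
    have prod: "mult_at (p i j) (\<Prod>l<s. linear_form (a l) ^ k l)
        = (\<Sum>l<s. mult_at (p i j) (linear_form (a l) ^ k l))"
      by (rule mult_at_prod) (use a0 in auto)
    have "mult_at (p i j) f = (\<Sum>l<s. mult_at (p i j) (linear_form (a l) ^ k l)) + mult_at (p i j) g"
      using f(2) unfolding fg by (simp add: mult_at_mult prod)
    also have "(\<Sum>l<s. mult_at (p i j) (linear_form (a l) ^ k l)) = (\<Sum>l<s. if l \<in> {i, j} then k l else 0)"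
      using a[OF ij] a0 by (intro sum.cong) (auto simp: mult_at_power mult_at_linear_form)
    also have "\<dots> = (\<Sum>l\<in>{i, j}. k l)"
      using ij by (intro sum.mono_neutral_cong_right) auto
    also have "\<dots> = k i + k j" using ij by simp
    finally show ?thesis using m[OF ij] by simp
  qed
  have "(s - 1) * m \<le> d + (s - 2) * k i" if i: "i < s" for i
  proof -
    let ?J = "{..<s} - {i}"
    \<comment> \<open>Line \<open>j\<close> passes through \<open>p i j\<close>, but through
      \<open>p i j'\<close> only when \<open>j = j'\<close>, as no three lines are
      concurrent.\<close>
    have inj: "inj_on (p i) ?J"
    proof (rule inj_onI)
      fix j j' assume jj: "j \<in> ?J" "j' \<in> ?J" "p i j = p i j'"
      have "dot (a j) (p i j) = 0" using a[of i j j] i jj by auto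
      then have "dot (a j) (p i j') = 0" using jj(3) by simp
      then show "j = j'" using a[of i j' j] i jj by auto
    qed
    have "(\<Sum>j\<in>?J. mult_at (p i j) g) \<le> e"
    proof (rule ccontr)
      assume "\<not> (\<Sum>j\<in>?J. mult_at (p i j) g) \<le> e"
      then have "linear_form (a i) dvd g"
        using i a b by (intro linear_form_dvd[OF g \<open>g \<noteq> 0\<close> a0[OF i] _ inj, of b]) auto
      then show False using ndvd i by blast
    qed
    moreover have "(\<Sum>j\<in>?J. m) \<le> (\<Sum>j\<in>?J. k i + k j + mult_at (p i j) g)"
      using bound i by (intro sum_mono) auto
    moreover have "(\<Sum>l<s. k l) = k i + (\<Sum>j\<in>?J. k j)"
      using i by (simp add: sum.remove)
    moreover have "card ?J = Suc (s - 2)" using i s by simp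
    moreover have "s - 1 = Suc (s - 2)" using s by simp
    ultimately show ?thesis
      using d by (simp add: sum.distrib)
  qed
  then show thesis using that[of k] d by simp
qed

lemma star_degree_ge:
  fixes f :: "'k::field_char_0 poly3"
  assumes star: "star_configuration s a b p" and s: "s \<ge> 2"
    and f: "form_of_degree d f" "f \<noteq> 0"
    and m: "\<And>i j. i < s \<Longrightarrow> j < s \<Longrightarrow> i \<noteq> j \<Longrightarrow> m \<le> mult_at (p i j) f"
  shows "s * m \<le> 2 * d"
proof -
  obtain k :: "nat \<Rightarrow> nat" where k: "(\<Sum>i<s. k i) \<le> d"
    "\<And>i. i < s \<Longrightarrow> (s - 1) * m \<le> d + (s - 2) * k i"
    using star_multiplicities[OF assms] by blast
  have "(\<Sum>i<s. (s - 1) * m) \<le> (\<Sum>i<s. d + (s - 2) * k i)"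
    using k(2) by (intro sum_mono) auto
  also have "\<dots> = s * d + (s - 2) * (\<Sum>i<s. k i)"
    by (simp add: sum.distrib sum_distrib_left)
  also have "\<dots> \<le> s * d + (s - 2) * d"
    using k(1) by simp
  \<comment> \<open>Here s + (s - 2) = 2 (s - 1), the truncated subtractions being exact for
    \<open>s \<ge> 2\<close>.\<close>
  also have "\<dots> = (s - 1) * (2 * d)"
  proof -
    obtain n where "s = 2 + n" using le_Suc_ex[OF s] by blast
    then show ?thesis by (simp add: algebra_simps)
  qed
  finally have "(s - 1) * (s * m) \<le> (s - 1) * (2 * d)"
    by (simp add: mult_ac)
  then show ?thesis using s by simp
qed

text \<open>Either some exponent \<open>k i\<close> is 0, and the inequality of that line alone
  gives the bound, or all \<open>s\<close> exponents are positive and already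
  \<open>s \<le> d\<close>.\<close>

lemma star_degree_ge_of_vanishing:
  fixes f :: "'k::field_char_0 poly3"
  assumes star: "star_configuration s a b p" and s: "s \<ge> 2"
    and f: "form_of_degree d f" "f \<noteq> 0"
    and m: "\<And>i j. i < s \<Longrightarrow> j < s \<Longrightarrow> i \<noteq> j \<Longrightarrow> 1 \<le> mult_at (p i j) f"
  shows "s - 1 \<le> d"
proof -
  obtain k :: "nat \<Rightarrow> nat" where k: "(\<Sum>i<s. k i) \<le> d"
    "\<And>i. i < s \<Longrightarrow> (s - 1) * 1 \<le> d + (s - 2) * k i"
    using star_multiplicities[OF assms] by blast
  show ?thesis
  proof (cases "\<exists>i<s. k i = 0")
    case True
    then show ?thesis using k(2) by fastforce
  next
    case False
    then have "(\<Sum>i<s. 1) \<le> (\<Sum>i<s. k i)"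
      by (intro sum_mono) (auto simp: Suc_le_eq)
    then show ?thesis using k(1) by simp
  qed
qed

subsection \<open>Powers of point ideals\<close>

lemma ideal_gen_base: "x \<in> S \<Longrightarrow> x \<in> ideal_gen S"
  unfolding ideal_gen_def by (rule module.span_base[OF module_times])

lemma ideal_gen_mult: "x \<in> ideal_gen S \<Longrightarrow> c * x \<in> ideal_gen S"
  unfolding ideal_gen_def by (rule module.span_scale[OF module_times])

lemma ideal_gen_induct [consumes 1, case_names zero add base]:
  assumes "x \<in> ideal_gen S" "P 0" "\<And>x y. P x \<Longrightarrow> P y \<Longrightarrow> P (x + y)"
    "\<And>c x. x \<in> S \<Longrightarrow> P (c * x)"
  shows "P x"
  using assms(1) unfolding ideal_gen_def
  by (induction rule: module.span_induct_alt[OF module_times, consumes 1]) (use assms in auto)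

lemma ideal_power_mult: "x \<in> ideal_power J m \<Longrightarrow> c * x \<in> ideal_power J m"
  by (cases m) (simp_all add: ideal_gen_mult)

lemma ideal_power_zero_mem: "0 \<in> ideal_power J m"
  by (cases m) (simp_all add: ideal_gen_def module.span_zero[OF module_times])

lemma ideal_power_plus_mem:
  "x \<in> ideal_power J m \<Longrightarrow> y \<in> ideal_power J m \<Longrightarrow> x + y \<in> ideal_power J m"
  by (cases m) (simp_all add: ideal_gen_def module.span_add[OF module_times])

lemma ideal_power_Suc_mem:
  "x \<in> J \<Longrightarrow> y \<in> ideal_power J m \<Longrightarrow> x * y \<in> ideal_power J (Suc m)"
  by (auto intro: ideal_gen_base)

lemma ideal_power_add:
  "x \<in> ideal_power J m \<Longrightarrow> y \<in> ideal_power J n \<Longrightarrow> x * y \<in> ideal_power J (m + n)"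
proof (induction m arbitrary: x)
  case 0
  then show ?case by (simp add: ideal_power_mult)
next
  case (Suc m)
  from Suc.prems(1) have "x \<in> ideal_gen {f * g | f g. f \<in> J \<and> g \<in> ideal_power J m}"
    by simp
  then show ?case
  proof (induction x rule: ideal_gen_induct)
    case zero
    show ?case by (simp only: mult_zero_left ideal_power_zero_mem)
  next
    case (add x x')
    then show ?case by (simp only: distrib_right ideal_power_plus_mem)
  next
    case (base c x)
    then obtain f g where "x = f * g" "f \<in> J" "g \<in> ideal_power J m" by blast
    then have "f * (g * y) \<in> ideal_power J (Suc (m + n))"
      using Suc.IH Suc.prems(2) by (intro ideal_power_Suc_mem)
    then have "c * (f * (g * y)) \<in> ideal_power J (Suc (m + n))"
      by (rule ideal_power_mult)
    then show ?case by (simp only: \<open>x = f * g\<close> mult.assoc add_Suc)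
  qed
qed

lemma mem_ideal_power_1: "x \<in> J \<Longrightarrow> x \<in> ideal_power J (Suc 0)"
  using ideal_power_Suc_mem[of x J 1 0] by simp

lemma power_mem_ideal_power: "x \<in> J \<Longrightarrow> x ^ m \<in> ideal_power J m"
proof (induction m)
  case (Suc m)
  then show ?case using ideal_power_Suc_mem by (simp del: ideal_power.simps(2))
qed simp

lemma mem_span_singleton: "v \<in> vec.span {v}"
  by (rule vec.span_base) simp

text \<open>The constant term of \<open>shift p f\<close> in t is the value of \<open>f\<close> at
  \<open>p\<close>, so vanishing at \<open>p\<close> is divisibility by t, a property inherited by
  the generated ideal.\<close>

lemma dvd_shift_point_ideal:
  assumes "f \<in> point_ideal (vec.span {p})"
  shows "[:0, 1:] dvd shift p f"
  using assms unfolding point_ideal_def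
proof (induction f rule: ideal_gen_induct)
  case zero
  show ?case by (simp add: ring_map_zero[OF ring_map_shift])
next
  case (add f g)
  then show ?case by (simp add: ring_map_add[OF ring_map_shift])
next
  case (base c f)
  then have "peval (\<lambda>a. a) (($) p) f = 0"
    using mem_span_singleton[of p] by (auto simp: eval3_eq_peval)
  then have "0 = Const (peval (\<lambda>a. a) (($) p) f)" by simp
  also have "\<dots> = poly (shift p f) 0"
    by (simp add: ring_map_comp_peval[OF ring_map_single] shift_def ring_map_comp_peval[OF ring_map_poly])
  finally have "[:0, 1:] dvd shift p f"
    using poly_eq_0_iff_dvd[of "shift p f" 0] by simp
  then show ?case by (simp add: ring_map_mult[OF ring_map_shift])
qed

lemma dvd_shift_ideal_power:
  assumes "f \<in> ideal_power (point_ideal (vec.span {p})) m"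
  shows "[:0, 1:] ^ m dvd shift p f"
  using assms
proof (induction m arbitrary: f)
  case (Suc m)
  from Suc.prems have "f \<in> ideal_gen {x * y | x y. x \<in> point_ideal (vec.span {p}) \<and>
      y \<in> ideal_power (point_ideal (vec.span {p})) m}"
    by simp
  then show ?case
  proof (induction f rule: ideal_gen_induct)
    case zero
    show ?case by (simp add: ring_map_zero[OF ring_map_shift])
  next
    case (add f g)
    then show ?case by (simp add: ring_map_add[OF ring_map_shift] del: power_Suc)
  next
    case (base c f)
    then obtain x y where "f = x * y" "x \<in> point_ideal (vec.span {p})"
      "y \<in> ideal_power (point_ideal (vec.span {p})) m" by blast
    then show ?case
      using Suc.IH[of y] dvd_shift_point_ideal[of x p]
      by (simp only: ring_map_mult[OF ring_map_shift] power_Suc dvd_mult mult_dvd_mono)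
  qed
qed simp

text \<open>The link from ideal powers to multiplicities: each of the \<open>m\<close> factors
  contributes one factor t. The degree bounds for stars reach symbolic powers through it.\<close>

lemma mult_at_ge:
  assumes "f \<in> ideal_power (point_ideal (vec.span {p})) m" "f \<noteq> 0"
  shows "m \<le> mult_at p f"
  using dvd_shift_ideal_power[OF assms(1)] order_divides[of 0 m "shift p f"] assms(2)
  by (simp add: mult_at_def)

lemma linear_form_mem_point_ideal:
  assumes "dot a p = 0"
  shows "linear_form a \<in> point_ideal (vec.span {p})"
  unfolding point_ideal_def
proof (rule ideal_gen_base, intro CollectI conjI exI ballI)
  show "form_of_degree 1 (linear_form a)" by (rule form_of_degree_linear_form)
  fix v assume "v \<in> vec.span {p}"
  then obtain c where "v = c *s p" by (auto simp: vec.span_singleton)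
  then have "eval3 (linear_form a) v = c * dot a p"
    by (simp add: eval3_eq_peval peval_linear_form[OF ring_map_id] dot_eq sum_3 algebra_simps)
  then show "eval3 (linear_form a) v = 0" using assms by simp
qed

subsection \<open>Waldschmidt constants\<close>

text \<open>Fekete's lemma. Fix \<open>n\<close> whose quotient is within \<open>r / 2\<close> of
  the infimum and divide \<open>m\<close> by \<open>n\<close>: the multiple of \<open>n\<close>
  contributes at most \<open>m\<close> times that quotient, the remainder a bounded amount that
  fades after division by \<open>m\<close>.\<close>

lemma subadditive_tendsto_INF:
  fixes f :: "nat \<Rightarrow> real"
  assumes sub: "\<And>m n. f (m + n) \<le> f m + f n" and nonneg: "\<And>n. 0 \<le> f n"
  shows "(\<lambda>n. f n / real n) \<longlonglongrightarrow> (INF n\<in>{1..}. f n / real n)"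
proof (rule LIMSEQ_I)
  fix r :: real assume r: "r > 0"
  define L where "L = (INF n\<in>{1..}. f n / real n)"
  have bdd: "bdd_below ((\<lambda>n. f n / real n) ` {1..})"
    by (rule bdd_belowI[of _ 0]) (auto simp: nonneg)
  have "\<exists>n\<in>{1..}. f n / real n < L + r / 2"
    using r bdd by (intro cINF_less_iff[THEN iffD1]) (auto simp: L_def)
  then obtain n where n: "n \<ge> 1" "f n / real n < L + r / 2" by auto
  \<comment> \<open>\<open>C\<close> bounds \<open>f\<close> at all remainders modulo
    \<open>n\<close> at once.\<close>
  define C where "C = (\<Sum>i<n. f i)"
  have mult: "f (q * n + i) \<le> real q * f n + f i" for q i
  proof (induction q)
    case (Suc q)
    have "f (Suc q * n + i) \<le> f n + f (q * n + i)"
      using sub[of n "q * n + i"] by (simp add: add.assoc)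
    with Suc show ?case by (simp add: algebra_simps)
  qed simp
  obtain N :: nat where N: "2 * C / r < real N" using reals_Archimedean2 by blast
  show "\<exists>no. \<forall>m\<ge>no. norm (f m / real m - L) < r"
  proof (intro exI allI impI)
    fix m assume m: "m \<ge> Suc N"
    have "f (m mod n) \<le> C"
      unfolding C_def using n(1) nonneg by (intro member_le_sum) auto
    then have "f m \<le> real (m div n) * f n + C"
      using mult[of "m div n" "m mod n"] by simp
    moreover have "real (m div n) * f n = (real (m div n) * real n) * (f n / real n)"
      using n(1) by simp
    moreover have "real (m div n) * real n \<le> real m"
      by (metis of_nat_mult of_nat_le_iff div_times_less_eq_dividend)
    ultimately have "f m \<le> real m * (f n / real n) + C"
      using nonneg[of n] by (smt (verit) divide_nonneg_nonneg mult_right_mono of_nat_0_le_iff)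
    then have "f m / real m \<le> (real m * (f n / real n) + C) / real m"
      by (rule divide_right_mono) simp
    then have "f m / real m \<le> f n / real n + C / real m"
      using m by (simp add: add_divide_distrib)
    moreover have "C / real m < r / 2"
    proof -
      have "2 * C / r < real m" using N m by simp
      then show ?thesis using r m by (simp add: field_simps)
    qed
    ultimately have "f m / real m < L + r" using n(2) by linarith
    moreover have "L \<le> f m / real m"
      unfolding L_def using m by (intro cINF_lower[OF bdd]) auto
    ultimately show "norm (f m / real m - L) < r" using r by simp
  qed
qed

section \<open>Initial degrees of symbolic powers\<close>

lemma initial_degree_le: "f \<in> J \<Longrightarrow> f \<noteq> 0 \<Longrightarrow> form_of_degree d f \<Longrightarrow> initial_degree J \<le> d"
  unfolding initial_degree_def by (intro Least_le) blast

lemma initial_degree_attained: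
  assumes "f \<in> J" "f \<noteq> 0" "form_of_degree d f"
  shows "\<exists>g\<in>J. g \<noteq> 0 \<and> form_of_degree (initial_degree J) g"
  unfolding initial_degree_def by (rule LeastI) (use assms in blast)

lemma proj_plane_cases:
  assumes "P \<in> proj_plane" obtains p where "P = vec.span {p}" "p \<noteq> 0"
  using assms by (auto simp: proj_plane_def)

text \<open>The cross product with the first axis vector works unless \<open>p\<close> is a multiple
  of that vector; then the second axis vector does.\<close>

lemma exists_orthogonal:
  fixes p :: "'k::field ^ 3" obtains a where "a \<noteq> 0" "dot a p = 0"
proof (cases "cross p (axis 1 1) = 0")
  case True
  then have "p $ 2 = 0"
    using cross_eq_0D[OF True, of 2 1] by (simp add: axis_def)
  then show thesis
    by (intro that[of "axis 2 1"]) (auto simp: dot_eq axis_def vec_eq_iff)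
next
  case False
  then show thesis by (rule that) simp
qed

lemma symbolic_power_mult:
  "f \<in> symbolic_power Z m \<Longrightarrow> g \<in> symbolic_power Z n \<Longrightarrow> f * g \<in> symbolic_power Z (m + n)"
  by (auto simp: symbolic_power_def intro: ideal_power_add)

lemma points_ideal_subset: "points_ideal Z \<subseteq> symbolic_power Z 1"
  unfolding points_ideal_def symbolic_power_def One_nat_def using mem_ideal_power_1 by blast

text \<open>Makes the \<open>LEAST\<close> in the initial degree meaningful. The form is a product
  of \<open>m\<close>-th powers of one line through each point.\<close>

lemma exists_form_symbolic_power:
  fixes Z :: "('k::field ^ 3) set set"
  assumes "finite Z" "Z \<subseteq> proj_plane"
  obtains d f where "f \<in> symbolic_power Z m" "f \<noteq> 0" "form_of_degree d f"
proof -
  have "\<exists>a. a \<noteq> 0 \<and> linear_form a \<in> point_ideal P" if "P \<in> Z" for P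
  proof -
    obtain p where P: "P = vec.span {p}" using \<open>P \<in> Z\<close> assms(2) by (auto elim: proj_plane_cases)
    obtain a where "a \<noteq> 0" "dot a p = 0" by (rule exists_orthogonal)
    then show ?thesis using linear_form_mem_point_ideal[of a p] P by blast
  qed
  then obtain a where a: "\<And>P. P \<in> Z \<Longrightarrow> a P \<noteq> 0" "\<And>P. P \<in> Z \<Longrightarrow> linear_form (a P) \<in> point_ideal P"
    by metis
  define f where "f = (\<Prod>P\<in>Z. linear_form (a P) ^ m)"
  have "f \<in> symbolic_power Z m"
    unfolding symbolic_power_def
  proof
    fix P assume P: "P \<in> Z"
    have "f = (\<Prod>P\<in>Z - {P}. linear_form (a P) ^ m) * linear_form (a P) ^ m"
      unfolding f_def by (simp add: prod.remove[OF assms(1) P])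
    also have "\<dots> \<in> ideal_power (point_ideal P) m"
      by (intro ideal_power_mult power_mem_ideal_power a(2) P)
    finally show "f \<in> ideal_power (point_ideal P) m" .
  qed
  moreover have "f \<noteq> 0"
    using assms(1) a(1) by (simp add: f_def)
  \<comment> \<open>The degree is a double sum so that each power, read as a product over
    \<open>{..<m}\<close>, falls under \<open>form_of_degree_prod\<close> as well.\<close>
  moreover have "form_of_degree (\<Sum>P\<in>Z. \<Sum>i<m. 1) f"
    unfolding f_def
    by (intro form_of_degree_prod, subst card_lessThan[of m, symmetric], subst prod_constant[symmetric])
      (intro form_of_degree_prod form_of_degree_linear_form)
  ultimately show thesis by (rule that)
qed

lemma initial_degree_symbolic_power_attained:
  fixes Z :: "('k::field ^ 3) set set"
  assumes "finite Z" "Z \<subseteq> proj_plane"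
  obtains f where "f \<in> symbolic_power Z m" "f \<noteq> 0"
    "form_of_degree (initial_degree (symbolic_power Z m)) f"
  using exists_form_symbolic_power[OF assms, of m thesis] initial_degree_attained by metis

text \<open>Products of forms of least degree make the initial degrees subadditive, so the limit
  exists. As an infimum, the constant is bounded above by any single form and below by an estimate
  valid for every \<open>m\<close>.\<close>

lemma waldschmidt_constant_eq_INF:
  fixes Z :: "('k::field ^ 3) set set"
  assumes "finite Z" "Z \<subseteq> proj_plane"
  shows "waldschmidt_constant Z = (INF m\<in>{1..}. real (initial_degree (symbolic_power Z m)) / real m)"
proof -
  have "initial_degree (symbolic_power Z (m + n))
      \<le> initial_degree (symbolic_power Z m) + initial_degree (symbolic_power Z n)" for m n
  proof -
    obtain f where f: "f \<in> symbolic_power Z m" "f \<noteq> 0"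
        "form_of_degree (initial_degree (symbolic_power Z m)) f"
      by (rule initial_degree_symbolic_power_attained[OF assms])
    obtain g where g: "g \<in> symbolic_power Z n" "g \<noteq> 0"
        "form_of_degree (initial_degree (symbolic_power Z n)) g"
      by (rule initial_degree_symbolic_power_attained[OF assms])
    show ?thesis
      using f g by (intro initial_degree_le[of "f * g"] symbolic_power_mult form_of_degree_mult) auto
  qed
  then have "(\<lambda>m. real (initial_degree (symbolic_power Z m)) / real m)
      \<longlonglongrightarrow> (INF m\<in>{1..}. real (initial_degree (symbolic_power Z m)) / real m)"
    by (intro subadditive_tendsto_INF) (simp_all flip: of_nat_add)
  then show ?thesis
    unfolding waldschmidt_constant_def by (rule limI)
qed

lemma waldschmidt_constant_le:
  fixes Z :: "('k::field ^ 3) set set"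
  assumes "finite Z" "Z \<subseteq> proj_plane" and m: "m \<ge> 1"
    and f: "f \<in> symbolic_power Z m" "f \<noteq> 0" "form_of_degree d f"
  shows "waldschmidt_constant Z \<le> real d / real m"
proof -
  have "bdd_below ((\<lambda>m. real (initial_degree (symbolic_power Z m)) / real m) ` {1..})"
    by (rule bdd_belowI[of _ 0]) auto
  then have "waldschmidt_constant Z \<le> real (initial_degree (symbolic_power Z m)) / real m"
    unfolding waldschmidt_constant_eq_INF[OF assms(1,2)] using m by (intro cINF_lower) auto
  also have "\<dots> \<le> real d / real m"
    using initial_degree_le[OF f] by (intro divide_right_mono) auto
  finally show ?thesis .
qed

lemma symbolic_power_mult_at_ge:
  "f \<in> symbolic_power Z m \<Longrightarrow> vec.span {p} \<in> Z \<Longrightarrow> f \<noteq> 0 \<Longrightarrow> m \<le> mult_at p f"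
  by (rule mult_at_ge) (auto simp: symbolic_power_def)

lemma waldschmidt_constant_star_ge:
  fixes Z :: "('k::field_char_0 ^ 3) set set"
  assumes Z: "finite Z" "Z \<subseteq> proj_plane"
    and star: "star_configuration s a b p" "s \<ge> 2"
    and p: "\<And>i j. i < s \<Longrightarrow> j < s \<Longrightarrow> i \<noteq> j \<Longrightarrow> vec.span {p i j} \<in> Z"
  shows "real s / 2 \<le> waldschmidt_constant Z"
  unfolding waldschmidt_constant_eq_INF[OF Z]
proof (rule cINF_greatest)
  fix m :: nat assume "m \<in> {1..}"
  then have m: "m > 0" by simp
  obtain f where f: "f \<in> symbolic_power Z m" "f \<noteq> 0"
      "form_of_degree (initial_degree (symbolic_power Z m)) f"
    by (rule initial_degree_symbolic_power_attained[OF Z])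
  have "s * m \<le> 2 * initial_degree (symbolic_power Z m)"
    by (rule star_degree_ge[OF star f(3,2)]) (intro symbolic_power_mult_at_ge[OF f(1)] p f(2))
  then have "real s * real m \<le> 2 * real (initial_degree (symbolic_power Z m))"
    by (metis of_nat_le_iff of_nat_mult of_nat_numeral)
  then show "real s / 2 \<le> real (initial_degree (symbolic_power Z m)) / real m"
    using m by (simp add: field_simps)
qed simp

section \<open>Collinear and noncollinear point sets\<close>

lemma collinearI:
  fixes Z :: "('k::field ^ 3) set set"
  assumes "Z \<subseteq> proj_plane" "a \<noteq> 0" "\<And>p. vec.span {p} \<in> Z \<Longrightarrow> dot a p = 0"
  shows "\<exists>a. a \<noteq> 0 \<and> Z \<subseteq> {P \<in> proj_plane. \<forall>v\<in>P. dot a v = 0}"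
proof (intro exI conjI subsetI CollectI ballI)
  fix P v assume P: "P \<in> Z" and v: "v \<in> P"
  then obtain p where p: "P = vec.span {p}" using assms(1) by (auto elim: proj_plane_cases)
  with v obtain c where "v = c *s p" by (auto simp: vec.span_singleton)
  then have "dot a v = c * dot a p" by (simp add: dot_eq algebra_simps)
  then show "dot a v = 0" using assms(3) P p by simp
qed (use assms in auto)

text \<open>If every point coincided with \<open>p\<close>, any line through \<open>p\<close> would
  contain \<open>Z\<close>. Otherwise some \<open>q\<close> differs, and the line
  \<open>cross p q\<close> through both must miss some \<open>r\<close>.\<close>

lemma noncollinear_triple:
  fixes Z :: "('k::field ^ 3) set set"
  assumes Z: "Z \<subseteq> proj_plane" "Z \<noteq> {}"
    and nc: "\<not> (\<exists>a. a \<noteq> 0 \<and> Z \<subseteq> {P \<in> proj_plane. \<forall>v\<in>P. dot a v = 0})"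
  obtains p q r where "vec.span {p} \<in> Z" "vec.span {q} \<in> Z" "vec.span {r} \<in> Z"
    "dot (cross p q) r \<noteq> 0"
proof -
  obtain p where p: "vec.span {p} \<in> Z" "p \<noteq> 0" using Z by (auto simp: proj_plane_def)
  have "\<exists>q. vec.span {q} \<in> Z \<and> cross p q \<noteq> 0"
  proof (rule ccontr)
    assume *: "\<not> ?thesis"
    obtain a where a: "a \<noteq> 0" "dot a p = 0" by (rule exists_orthogonal)
    obtain i where i: "p $ i \<noteq> 0" using p(2) by (auto simp: vec_eq_iff)
    have "dot a q = 0" if "vec.span {q} \<in> Z" for q
    proof -
      have "p $ i * q $ j = q $ i * p $ j" for j
        using * that by (intro cross_eq_0D) blast
      then have "p $ i * dot a q = q $ i * dot a p"
        by (simp add: dot_eq distrib_left mult.left_commute[of _ "a $ _"])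
      then show ?thesis using i a(2) by simp
    qed
    then show False using nc collinearI[OF Z(1) a(1)] by blast
  qed
  then obtain q where q: "vec.span {q} \<in> Z" "cross p q \<noteq> 0" by blast
  obtain r where "vec.span {r} \<in> Z" "dot (cross p q) r \<noteq> 0"
    using nc collinearI[OF Z(1) q(2)] by blast
  then show thesis using that p(1) q(1) by blast
qed

text \<open>The sides of a triangle form a star. Side \<open>k\<close> is opposite vertex
  \<open>x k\<close>, so sides \<open>i\<close> and \<open>j\<close> meet in the third vertex, of
  index \<open>3 - i - j\<close> because 0 + 1 + 2 = 3.\<close>

lemma triangle_star_configuration:
  fixes p q r :: "'k::field ^ 3"
  assumes D: "dot (cross p q) r \<noteq> 0"
  defines "x \<equiv> (\<lambda>k::nat. if k = 0 then p else if k = 1 then q else r)"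
  shows "\<exists>a b. star_configuration 3 a b (\<lambda>i j. x (3 - i - j))"
proof -
  define D where "D = dot (cross p q) r"
  define a where "a k = (if k = 0 then cross q r else if k = 1 then cross r p else cross p q)" for k :: nat
  \<comment> \<open>Each side takes the value \<open>D\<close> at its opposite vertex and 0 at the
    other two, so this average is 1 at every vertex.\<close>
  define b where "b = (\<chi> i. (a 0 $ i + a 1 $ i + a 2 $ i) / D)"
  have D0: "D \<noteq> 0" using assms by (simp add: D_def)
  have diag: "dot (cross q r) p = D" "dot (cross r p) q = D" "dot (cross p q) r = D"
    using dot_cross_rotate[of p q r] dot_cross_rotate[of q r p] by (simp_all add: D_def)
  have ax: "dot (a l) (x k) = (if l = k then D else 0)" if "l < 3" "k < 3" for l k
    using that by (auto simp: less_Suc_eq numeral_3_eq_3 a_def x_def diag)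
  have a0: "a l \<noteq> 0" if "l < 3" for l
  proof
    assume "a l = 0"
    then have "dot (a l) (x l) = 0" by (simp add: dot_eq)
    then show False using ax[OF that that] D0 by simp
  qed
  have b: "dot b (x k) = 1" if "k < 3" for k
  proof -
    have "D * dot b (x k) = dot (a 0) (x k) + dot (a 1) (x k) + dot (a 2) (x k)"
      using D0 by (simp add: b_def dot_eq field_simps)
    also have "\<dots> = D"
      using that ax[of 0 k] ax[of 1 k] ax[of 2 k] by (auto simp: less_Suc_eq numeral_3_eq_3)
    finally show ?thesis using D0 by simp
  qed
  have "star_configuration 3 a b (\<lambda>i j. x (3 - i - j))"
    unfolding star_configuration_def
  proof (intro conjI allI impI)
    fix i j l :: nat assume ij: "i < 3" "j < 3" "i \<noteq> j"
    then have k: "3 - i - j < 3" by simp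
    show "dot b (x (3 - i - j)) = 1" by (rule b[OF k])
    assume l: "l < 3"
    show "dot (a l) (x (3 - i - j)) = 0 \<longleftrightarrow> l = i \<or> l = j"
      unfolding ax[OF l k] using ij l D0 by (auto simp: less_Suc_eq numeral_3_eq_3)
  qed (rule a0)
  then show ?thesis by blast
qed

text \<open>An empty intersection of ideals is the whole ring and contains 1. This excludes the
  empty set in part (i).\<close>

lemma waldschmidt_constant_empty: "waldschmidt_constant ({} :: ('k::field ^ 3) set set) = 0"
proof -
  have "initial_degree (symbolic_power ({} :: ('k ^ 3) set set) m) \<le> 0" for m
    by (rule initial_degree_le[of 1]) (simp_all add: symbolic_power_def form_of_degree_1)
  then show ?thesis by (simp add: waldschmidt_constant_def)
qed

lemma form_of_degree_0_point_ideal: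
  fixes f :: "'k::field poly3"
  assumes f: "form_of_degree 0 f" "f \<in> point_ideal (vec.span {p})"
  shows "f = 0"
proof -
  let ?c = "peval (\<lambda>x. x) (\<lambda>_. 0) f"
  \<comment> \<open>Scaling the variables by 0 multiplies a form of degree 0 by 0^0 = 1, so
    \<open>f\<close> is constant.\<close>
  have "f = peval Const (\<lambda>i. 0 * Var i) f"
    using peval_homogeneous[OF f(1), of Const 0 Var] by simp
  also have "\<dots> = Const ?c"
    by (simp add: ring_map_comp_peval[OF ring_map_single])
  finally have c: "f = Const ?c" .
  have "shift p f = [:Const ?c:]"
    by (subst c) (simp add: shift_def peval_Const[OF ring_map_const_poly[OF ring_map_single]])
  then have "Const ?c = 0"
    using dvd_shift_point_ideal[OF f(2)] poly_eq_0_iff_dvd[of "shift p f" 0] by simp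
  then show ?thesis using c by simp
qed

text \<open>The equation of the line attains degree 1, and a nonzero constant cannot vanish at a
  point of \<open>Z\<close>.\<close>

lemma initial_degree_collinear:
  fixes Z :: "('k::field ^ 3) set set"
  assumes Z: "Z \<noteq> {}" "Z \<subseteq> proj_plane" and a: "a \<noteq> 0" "\<And>p. vec.span {p} \<in> Z \<Longrightarrow> dot a p = 0"
  shows "initial_degree (points_ideal Z) = 1"
proof (rule antisym)
  have l: "linear_form a \<in> points_ideal Z"
    unfolding points_ideal_def
  proof
    fix P assume P: "P \<in> Z"
    then obtain p where "P = vec.span {p}" using Z(2) by (auto elim: proj_plane_cases)
    then show "linear_form a \<in> point_ideal P"
      using linear_form_mem_point_ideal a(2) P by blast
  qed
  have l0: "linear_form a \<noteq> 0" using a(1) by simp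
  show "initial_degree (points_ideal Z) \<le> 1"
    by (rule initial_degree_le[OF l l0 form_of_degree_linear_form])
  obtain g where g: "g \<in> points_ideal Z" "g \<noteq> 0" "form_of_degree (initial_degree (points_ideal Z)) g"
    using initial_degree_attained[OF l l0 form_of_degree_linear_form] by blast
  obtain p where p: "vec.span {p} \<in> Z" using Z by (auto simp: proj_plane_def)
  then have "g \<in> point_ideal (vec.span {p})" using g(1) by (auto simp: points_ideal_def)
  then have "initial_degree (points_ideal Z) \<noteq> 0"
    using form_of_degree_0_point_ideal[of g p] g(2,3) by metis
  then show "1 \<le> initial_degree (points_ideal Z)" by simp
qed

lemma waldschmidt_constant_1_collinear:
  fixes Z :: "('k::field_char_0 ^ 3) set set"
  assumes Z: "finite Z" "Z \<subseteq> proj_plane" and w: "waldschmidt_constant Z = 1"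
  shows "initial_degree (points_ideal Z) = 1 \<and> (\<exists>L. proj_line L \<and> Z \<subseteq> L)"
proof -
  have ne: "Z \<noteq> {}" using w by (auto simp: waldschmidt_constant_empty)
  have "\<exists>a. a \<noteq> 0 \<and> Z \<subseteq> {P \<in> proj_plane. \<forall>v\<in>P. dot a v = 0}"
  proof (rule ccontr)
    assume nc: "\<not> ?thesis"
    obtain p q r where pqr: "vec.span {p} \<in> Z" "vec.span {q} \<in> Z" "vec.span {r} \<in> Z"
      and D: "dot (cross p q) r \<noteq> 0"
      by (rule noncollinear_triple[OF Z(2) ne nc])
    obtain a b where "star_configuration 3 a b
        (\<lambda>i j. if 3 - i - j = (0::nat) then p else if 3 - i - j = 1 then q else r)"
      using triangle_star_configuration[OF D] by auto
    then have "real 3 / 2 \<le> waldschmidt_constant Z"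
      by (rule waldschmidt_constant_star_ge[OF Z]) (use pqr in auto)
    then show False using w by simp
  qed
  then obtain a where a: "a \<noteq> 0" "Z \<subseteq> {P \<in> proj_plane. \<forall>v\<in>P. dot a v = 0}" by blast
  have "initial_degree (points_ideal Z) = 1"
    by (rule initial_degree_collinear[OF ne Z(2) a(1)]) (use a(2) mem_span_singleton in blast)
  moreover have "proj_line {P \<in> proj_plane. \<forall>v\<in>P. dot a v = 0}"
    using a(1) by (auto simp: proj_line_def dot_def)
  ultimately show ?thesis using a(2) by blast
qed

section \<open>Lines in general position and the sets for part (ii)\<close>

lemma exists_star_configuration:
  "\<exists>(a :: nat \<Rightarrow> 'k::field_char_0 ^ 3) b p. star_configuration s a b p"
proof -
  \<comment> \<open>The lines are points of a conic in the dual plane. At \<open>p i j\<close> line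
    \<open>l\<close> takes the value (l - i)(l - j), which vanishes only for \<open>i\<close> and
    \<open>j\<close> since natural numbers stay distinct in characteristic 0.\<close>
  define a :: "nat \<Rightarrow> 'k ^ 3" where "a l = vector [1, of_nat l, of_nat l ^ 2]" for l
  define p :: "nat \<Rightarrow> nat \<Rightarrow> 'k ^ 3"
    where "p i j = vector [of_nat i * of_nat j, - (of_nat i + of_nat j), 1]" for i j
  have "dot (a l) (p i j) = (of_nat l - of_nat i) * (of_nat l - of_nat j)" for i j l
    by (simp add: a_def p_def dot_eq vector_3 algebra_simps power2_eq_square)
  then have "dot (a l) (p i j) = 0 \<longleftrightarrow> l = i \<or> l = j" for i j l by simp
  moreover have "dot (axis 3 1) (p i j) = 1" for i j
    by (simp add: p_def dot_eq vector_3 axis_def)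
  moreover have "a l \<noteq> 0" for l
    by (auto simp: a_def vec_eq_iff vector_3 intro: exI[of _ 1])
  ultimately show ?thesis unfolding star_configuration_def by blast
qed

lemma exists_waldschmidt_constant_eq:
  assumes d: "d \<ge> 2"
  shows "\<exists>Z :: ('k::field_char_0 ^ 3) set set. finite Z \<and> Z \<subseteq> proj_plane \<and>
    waldschmidt_constant Z = real d \<and> initial_degree (points_ideal Z) \<ge> d + 1"
proof -
  define s where "s = 2 * d"
  have s: "s \<ge> 2" using d by (simp add: s_def)
  obtain a b and p :: "nat \<Rightarrow> nat \<Rightarrow> 'k ^ 3" where star: "star_configuration s a b p"
    using exists_star_configuration by blast
  define Z where "Z = (\<lambda>(i, j). vec.span {p i j}) ` {(i, j). i < s \<and> j < s \<and> i \<noteq> j}"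
  have Z_mem: "vec.span {p i j} \<in> Z" if "i < s" "j < s" "i \<noteq> j" for i j
    unfolding Z_def using that by force
  have "finite {(i, j). i < s \<and> j < s \<and> i \<noteq> j}"
    by (rule finite_subset[of _ "{..<s} \<times> {..<s}"]) auto
  then have fin: "finite Z" by (simp add: Z_def)
  have "p i j \<noteq> 0" if "i < s" "j < s" "i \<noteq> j" for i j
  proof
    assume "p i j = 0"
    moreover have "dot b (p i j) = 1" using star that by (simp add: star_configuration_def)
    ultimately show False by (simp add: dot_eq)
  qed
  then have Zp: "Z \<subseteq> proj_plane"
    by (auto simp: Z_def proj_plane_def)
  have a0: "a i \<noteq> 0" if "i < s" for i
    using star that by (simp add: star_configuration_def)
  define f where "f = (\<Prod>i<s. linear_form (a i))"
  have f0: "f \<noteq> 0" using a0 by (simp add: f_def)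
  have "form_of_degree (\<Sum>i<s. 1) f"
    unfolding f_def by (intro form_of_degree_prod form_of_degree_linear_form)
  then have f_form: "form_of_degree s f" by simp
  \<comment> \<open>Splitting off the two lines through \<open>p i j\<close> exhibits
    \<open>f\<close> in the square of the ideal of that point.\<close>
  have f_eq: "f = linear_form (a i) * (linear_form (a j) * (\<Prod>i\<in>{..<s} - {i} - {j}. linear_form (a i)))"
    if "i < s" "j < s" "i \<noteq> j" for i j
    unfolding f_def using that by (subst prod.remove[of _ i], simp, simp, subst prod.remove[of _ j]) auto
  have l: "linear_form (a i) \<in> point_ideal (vec.span {p i j})"
    "linear_form (a j) \<in> point_ideal (vec.span {p i j})" if "i < s" "j < s" "i \<noteq> j" for i j
    using star that unfolding star_configuration_def by (blast intro: linear_form_mem_point_ideal)+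
  have f_mem: "f \<in> symbolic_power Z 2"
    unfolding symbolic_power_def
  proof
    fix P assume "P \<in> Z"
    then obtain i j where ij: "i < s" "j < s" "i \<noteq> j" and P: "P = vec.span {p i j}"
      by (auto simp: Z_def)
    note f_eq[OF ij]
    also have "linear_form (a i) * (linear_form (a j) * (\<Prod>i\<in>{..<s} - {i} - {j}. linear_form (a i)))
        \<in> ideal_power (point_ideal P) (Suc (Suc 0))"
      unfolding P by (intro ideal_power_Suc_mem l[OF ij]) simp
    finally show "f \<in> ideal_power (point_ideal P) 2" by (simp only: numeral_2_eq_2)
  qed
  have "waldschmidt_constant Z \<le> real s / real 2"
    by (rule waldschmidt_constant_le[OF fin Zp _ f_mem f0 f_form]) simp
  moreover have "real s / 2 \<le> waldschmidt_constant Z"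
    by (rule waldschmidt_constant_star_ge[OF fin Zp star s Z_mem])
  ultimately have "waldschmidt_constant Z = real d" by (simp add: s_def)
  moreover have "d + 1 \<le> initial_degree (points_ideal Z)"
  proof -
    have "f \<in> points_ideal Z"
      unfolding points_ideal_def
    proof
      fix P assume "P \<in> Z"
      then obtain i j where ij: "i < s" "j < s" "i \<noteq> j" and P: "P = vec.span {p i j}"
        by (auto simp: Z_def)
      show "f \<in> point_ideal P"
        unfolding f_eq[OF ij] P mult.commute[of "linear_form (a i)"]
        using l(1)[OF ij] unfolding point_ideal_def by (rule ideal_gen_mult)
    qed
    obtain g where g: "g \<in> points_ideal Z" "g \<noteq> 0"
        "form_of_degree (initial_degree (points_ideal Z)) g"
      using initial_degree_attained[OF \<open>f \<in> points_ideal Z\<close> f0 f_form] by blast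
    have "s - 1 \<le> initial_degree (points_ideal Z)"
      using g(1) points_ideal_subset
      by (intro star_degree_ge_of_vanishing[OF star s g(3,2)] symbolic_power_mult_at_ge[of g Z 1] Z_mem g(2)) auto
    \<comment> \<open>For \<open>d \<ge> 2\<close> one has
      \<open>2 * d - 1 \<ge> d + 1\<close>.\<close>
    then show ?thesis using d by (simp add: s_def)
  qed
  ultimately show ?thesis using fin Zp by blast
qed

theorem corollaryB:
  shows "(\<forall>Z :: ('k::{alg_closed_field, field_char_0} ^ 3) set set.
           finite Z \<and> Z \<subseteq> proj_plane \<and> waldschmidt_constant Z = 1 \<longrightarrow>
             initial_degree (points_ideal Z) = 1 \<and> (\<exists>L. proj_line L \<and> Z \<subseteq> L)) \<and>
         (\<forall>d::nat. d \<ge> 2 \<longrightarrow> (\<exists>Z :: ('k ^ 3) set set.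
           finite Z \<and> Z \<subseteq> proj_plane \<and> waldschmidt_constant Z = real d \<and>
             initial_degree (points_ideal Z) \<ge> d + 1))"
  using waldschmidt_constant_1_collinear exists_waldschmidt_constant_eq by blast

end
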